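(* Let $v(x)={}^t\!xQx$ be a positive definite quadratic form on $\mathbb{R}^n$, let $\pi(x)=p_1x_1+\cdots+p_nx_n$ be a nonzero linear form, $p={}^t(p_1,\dots,p_n)$. Let $x_0\in\mathbb{R}^n$ satisfy $v(x_0)=a_0$ and $\pi(x_0)=r_0$ with $r_0\ge0$. The following six statements are equivalent: (i) $x_0\in\mathrm{Ef}_p^{(Q)}$. (ii) $\pi(x_0)=\max_{v(x)\le a_0}\pi(x)$ and $v(x_0)=\min_{\pi(x)\ge r_0}v(x)$. (iii) $\pi(x_0)=\max_{v(x)\le a_0}\pi(x)$. (iv) $\pi(x_0)=\max_{v(x)=a_0}\pi(x)$. (v) $v(x_0)=\min_{\pi(x)\ge r_0}v(x)$. (vi) $v(x_0)=\min_{\pi(x)=r_0}v(x)$. (All maxima and minima are over $x\in\mathbb{R}^n$ satisfying the indicated condition.)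
   Context: $n\ge1$ and $Q$ is a symmetric positive definite $n\times n$ matrix. Put $c_p=({}^tpQ^{-1}p)^{-1}$ and $E_p^{(Q)}=\{(a,r)\mid a=c_pr^2,\ r\ge0\}$. For $(a,r)\in E_p^{(Q)}$ with $r>0$ put $x(a,r)=\frac{a}{r}Q^{-1}p$, and put $x(0,0)=0$. Then $\mathrm{Ef}_p^{(Q)}=\{x(a,r)\mid(a,r)\in E_p^{(Q)}\}\subset\mathbb{R}^n$. *)

theory Defs
  imports "HOL-Analysis.Analysis"
begin

definition sym_pos_def :: "real ^ 'n ^ 'n \<Rightarrow> bool" where
  "sym_pos_def Q \<longleftrightarrow> transpose Q = Q \<and> (\<forall>x. x \<noteq> 0 \<longrightarrow> x \<bullet> (Q *v x) > 0)"

definition qform :: "real ^ 'n ^ 'n \<Rightarrow> real ^ 'n \<Rightarrow> real" where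
  "qform Q x = x \<bullet> (Q *v x)"

definition linform :: "real ^ 'n \<Rightarrow> real ^ 'n \<Rightarrow> real" where
  "linform p x = (\<Sum>i\<in>UNIV. p $ i * x $ i)"

definition eff_const :: "real ^ 'n ^ 'n \<Rightarrow> real ^ 'n \<Rightarrow> real" where
  "eff_const Q p = inverse (p \<bullet> (matrix_inv Q *v p))"

definition eff_curve :: "real ^ 'n ^ 'n \<Rightarrow> real ^ 'n \<Rightarrow> (real \<times> real) set" where
  "eff_curve Q p = {(a, r). a = eff_const Q p * r\<^sup>2 \<and> r \<ge> 0}"

(* Only used on eff_curve Q p, whose only point with r = 0 is (0, 0). *)
definition eff_point :: "real ^ 'n ^ 'n \<Rightarrow> real ^ 'n \<Rightarrow> real \<Rightarrow> real \<Rightarrow> real ^ 'n" where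
  "eff_point Q p a r = (if r > 0 then (a / r) *\<^sub>R (matrix_inv Q *v p) else 0)"

definition eff_set :: "real ^ 'n ^ 'n \<Rightarrow> real ^ 'n \<Rightarrow> (real ^ 'n) set" where
  "eff_set Q p = {eff_point Q p a r | a r. (a, r) \<in> eff_curve Q p}"

(* "m = max A" and "m = min A" for possibly infinite sets of reals; both include
   that the extremum is attained. Max and Min are only meaningful on finite sets. *)
definition is_maximum :: "real \<Rightarrow> real set \<Rightarrow> bool" where
  "is_maximum m A \<longleftrightarrow> m \<in> A \<and> (\<forall>y\<in>A. y \<le> m)"

definition is_minimum :: "real \<Rightarrow> real set \<Rightarrow> bool" where
  "is_minimum m A \<longleftrightarrow> m \<in> A \<and> (\<forall>y\<in>A. m \<le> y)"

end

theory Submission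
  imports Defs
begin

text \<open>Write \<open>w = Q\<^sup>-\<^sup>1 p\<close> and \<open>D = p \<bullet> w\<close>. Completing the square gives
  \<open>D \<cdot> v(x) - \<pi>(x)\<^sup>2 = D \<cdot> v(x - (\<pi>(x)/D) w)\<close>, the Cauchy--Schwarz inequality for the inner product
  of \<open>Q\<close> with its equality case. Since the efficient set is the ray \<open>{t w | t \<ge> 0}\<close>, it consists
  of the points with \<open>\<pi>(x) \<ge> 0\<close> and \<open>D \<cdot> v(x) = \<pi>(x)\<^sup>2\<close>, and each of the extremal conditions forces
  this equality when compared with a suitable point of the ray.\<close>

lemma linform_eq_inner: "linform p x = p \<bullet> x"
  by (simp add: linform_def inner_vec_def)

lemma qform_scaleR: "qform Q (c *\<^sub>R x) = c\<^sup>2 * qform Q x"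
  by (simp add: qform_def matrix_vector_mult_scaleR power2_eq_square)

lemma sym_inner_mult_commute:
  fixes Q :: "real ^ 'n ^ 'n"
  assumes "transpose Q = Q"
  shows "x \<bullet> (Q *v y) = y \<bullet> (Q *v x)"
  by (metis assms dot_lmul_matrix inner_commute transpose_matrix_vector)

lemma qform_diff:
  assumes "transpose Q = Q"
  shows "qform Q (x - y) = qform Q x - 2 * (x \<bullet> (Q *v y)) + qform Q y"
  using sym_inner_mult_commute[OF assms, of x y]
  by (simp add: qform_def matrix_vector_mult_diff_distrib inner_diff_left inner_diff_right)

lemma qform_nonneg: "sym_pos_def Q \<Longrightarrow> 0 \<le> qform Q x"
  unfolding sym_pos_def_def qform_def
  by (cases "x = 0") (auto intro: less_imp_le)

lemma qform_eq_0_iff: "sym_pos_def Q \<Longrightarrow> qform Q x = 0 \<longleftrightarrow> x = 0"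
  unfolding sym_pos_def_def qform_def
  by (cases "x = 0") (auto simp: less_le)

text \<open>A kernel vector has \<open>qform\<close> value 0 and hence vanishes, so \<open>Q\<close>
  is invertible. Since \<open>matrix_inv\<close> is a Hilbert choice, its defining property is then
  extracted from the existence of an inverse.\<close>

lemma sym_pos_def_inv_mult:
  fixes Q :: "real ^ 'n ^ 'n"
  assumes "sym_pos_def Q"
  shows "Q *v (matrix_inv Q *v p) = p"
proof -
  have "x = 0" if "Q *v x = 0" for x
    using that qform_eq_0_iff[OF assms, of x] by (simp add: qform_def)
  then have "invertible Q"
    by (metis invertible_left_inverse matrix_left_invertible_ker)
  then have "Q ** matrix_inv Q = mat 1"
    unfolding invertible_def matrix_inv_def by (rule someI2_ex) simp
  then show ?thesis
    by (simp add: matrix_vector_mul_assoc)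
qed

context
  fixes Q :: "real ^ 'n ^ 'n" and p w :: "real ^ 'n" and D :: real
  assumes Q: "sym_pos_def Q" and p: "p \<noteq> 0"
  defines "w \<equiv> matrix_inv Q *v p" and "D \<equiv> p \<bullet> w"
begin

lemma Q_mult_w: "Q *v w = p"
  unfolding w_def using Q by (rule sym_pos_def_inv_mult)

lemma qform_w: "qform Q w = D"
  by (simp add: qform_def Q_mult_w D_def inner_commute)

lemma D_pos: "D > 0"
proof -
  have "w \<noteq> 0" using Q_mult_w p by auto
  then have "qform Q w \<noteq> 0" by (simp add: qform_eq_0_iff[OF Q])
  then show ?thesis using qform_nonneg[OF Q, of w] qform_w by linarith
qed

lemma linform_w: "linform p (t *\<^sub>R w) = t * D"
  by (simp add: linform_eq_inner D_def)

text \<open>As \<open>Q *v w = p\<close>, \<open>linform p x\<close> is the \<open>Q\<close>-inner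
  product of \<open>x\<close> and \<open>w\<close>, so the subtracted vector is the
  \<open>Q\<close>-orthogonal projection of \<open>x\<close> onto the line of \<open>w\<close>. The
  identity is Pythagoras scaled by \<open>D\<close>.\<close>

lemma complete_square:
  "D * qform Q x - (linform p x)\<^sup>2 = D * qform Q (x - (linform p x / D) *\<^sub>R w)"
proof -
  have "transpose Q = Q" using Q by (simp add: sym_pos_def_def)
  from qform_diff[OF this, of x "(linform p x / D) *\<^sub>R w"]
  have "qform Q (x - (linform p x / D) *\<^sub>R w) = qform Q x - (linform p x)\<^sup>2 / D"
    using D_pos
    by (simp add: qform_scaleR qform_w matrix_vector_mult_scaleR Q_mult_w linform_eq_inner
        inner_commute[of x] power2_eq_square)
  then show ?thesis
    using D_pos by (simp add: right_diff_distrib)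
qed

lemma linform_square_le: "(linform p x)\<^sup>2 \<le> D * qform Q x"
  using complete_square[of x] D_pos qform_nonneg[OF Q, of "x - (linform p x / D) *\<^sub>R w"]
  by (smt (verit) mult_nonneg_nonneg)

lemma linform_square_eq_iff:
  "D * qform Q x = (linform p x)\<^sup>2 \<longleftrightarrow> x = (linform p x / D) *\<^sub>R w"
  using complete_square[of x] D_pos qform_eq_0_iff[OF Q, of "x - (linform p x / D) *\<^sub>R w"]
  by auto

lemma eff_set_eq_ray: "eff_set Q p = {(r / D) *\<^sub>R w | r. r \<ge> 0}"
proof -
  \<comment> \<open>Here \<open>eff_const Q p\<close> is \<open>1 / D\<close>, so
    \<open>a / r\<close> becomes \<open>r / D\<close>; for \<open>r = 0\<close> the default value 0
    agrees with the ray.\<close>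
  have "eff_point Q p (eff_const Q p * r\<^sup>2) r = (r / D) *\<^sub>R w" if "r \<ge> 0" for r
    using that by (auto simp: eff_point_def eff_const_def w_def D_def power2_eq_square field_simps)
  then show ?thesis
    by (force simp: eff_set_def eff_curve_def)
qed

text \<open>Equality in Cauchy--Schwarz places \<open>x\<close> on the line of \<open>w\<close>, and
  the sign condition selects the ray.\<close>

lemma mem_eff_set_iff:
  "x \<in> eff_set Q p \<longleftrightarrow> linform p x \<ge> 0 \<and> (linform p x)\<^sup>2 = D * qform Q x"
proof
  assume "x \<in> eff_set Q p"
  then obtain r where r: "r \<ge> 0" "x = (r / D) *\<^sub>R w"
    by (auto simp: eff_set_eq_ray)
  then have "linform p x = r"
    using D_pos linform_w by simp
  with r show "linform p x \<ge> 0 \<and> (linform p x)\<^sup>2 = D * qform Q x"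
    using linform_square_eq_iff[of x] by simp
next
  assume *: "linform p x \<ge> 0 \<and> (linform p x)\<^sup>2 = D * qform Q x"
  then have "x = (linform p x / D) *\<^sub>R w"
    using linform_square_eq_iff[of x] by simp
  with * show "x \<in> eff_set Q p"
    unfolding eff_set_eq_ray by blast
qed

text \<open>Cauchy--Schwarz at \<open>x\<close> is compared with its equality case at
  \<open>x0\<close>; the root may be taken because \<open>linform p x0\<close> is
  nonnegative.\<close>

lemma eff_set_linform_le:
  assumes "x0 \<in> eff_set Q p" "qform Q x \<le> qform Q x0"
  shows "linform p x \<le> linform p x0"
proof (rule power2_le_imp_le)
  have "(linform p x)\<^sup>2 \<le> D * qform Q x" by (rule linform_square_le)
  also have "\<dots> \<le> D * qform Q x0" using assms(2) D_pos by simp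
  also have "\<dots> = (linform p x0)\<^sup>2" using assms(1) mem_eff_set_iff by simp
  finally show "(linform p x)\<^sup>2 \<le> (linform p x0)\<^sup>2" .
qed (use assms(1) mem_eff_set_iff in simp)

lemma eff_set_qform_le:
  assumes "x0 \<in> eff_set Q p" "linform p x0 \<le> linform p x"
  shows "qform Q x0 \<le> qform Q x"
proof -
  have "D * qform Q x0 = (linform p x0)\<^sup>2" using assms(1) mem_eff_set_iff[of x0] by simp
  also have "\<dots> \<le> (linform p x)\<^sup>2" using assms mem_eff_set_iff[of x0] by (intro power_mono) auto
  also have "\<dots> \<le> D * qform Q x" by (rule linform_square_le)
  finally show ?thesis using D_pos by simp
qed

text \<open>Testing maximality on the ray point with the same \<open>qform\<close> value as
  \<open>x0\<close> gives the reverse Cauchy--Schwarz inequality at \<open>x0\<close>.\<close>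

lemma mem_eff_setI_linform:
  assumes "linform p x0 \<ge> 0" "\<And>x. qform Q x = qform Q x0 \<Longrightarrow> linform p x \<le> linform p x0"
  shows "x0 \<in> eff_set Q p"
proof -
  \<comment> \<open>Solves \<open>qform Q (t *\<^sub>R w) = qform Q x0\<close> with
    \<open>t \<ge> 0\<close>, using \<open>qform Q w = D\<close>.\<close>
  define t where "t = sqrt (qform Q x0 / D)"
  have t: "t\<^sup>2 * D = qform Q x0" "t \<ge> 0"
    using D_pos qform_nonneg[OF Q, of x0] by (simp_all add: t_def)
  then have "t * D \<le> linform p x0"
    using assms(2)[of "t *\<^sub>R w"] by (simp add: qform_scaleR qform_w linform_w)
  then have "(t * D)\<^sup>2 \<le> (linform p x0)\<^sup>2"
    using t D_pos by (simp add: power_mono)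
  moreover have "(t * D)\<^sup>2 = D * qform Q x0"
    by (simp add: t(1)[symmetric] power2_eq_square)
  ultimately show ?thesis
    using assms(1) linform_square_le[of x0] mem_eff_set_iff by simp
qed

text \<open>The test point is now the projection of \<open>x0\<close> onto the line of
  \<open>w\<close>, which has the same \<open>linform\<close> value as \<open>x0\<close>.\<close>

lemma mem_eff_setI_qform:
  assumes "linform p x0 \<ge> 0" "\<And>x. linform p x = linform p x0 \<Longrightarrow> qform Q x0 \<le> qform Q x"
  shows "x0 \<in> eff_set Q p"
proof -
  have "qform Q x0 \<le> (linform p x0 / D)\<^sup>2 * D"
    using assms(2)[of "(linform p x0 / D) *\<^sub>R w"] D_pos
    by (simp add: qform_scaleR qform_w linform_w)
  then have "D * qform Q x0 \<le> (linform p x0)\<^sup>2"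
    using D_pos by (simp add: field_simps power2_eq_square)
  then show ?thesis
    using assms(1) linform_square_le[of x0] mem_eff_set_iff by simp
qed

end

theorem theorem3p2p9:
  fixes Q :: "real ^ 'n ^ 'n" and p x0 :: "real ^ 'n" and a0 r0 :: real
  assumes "sym_pos_def Q"
    and "p \<noteq> 0"
    and "qform Q x0 = a0"
    and "linform p x0 = r0"
    and "r0 \<ge> 0"
  shows
    "(x0 \<in> eff_set Q p \<longleftrightarrow>
        is_maximum (linform p x0) {linform p x | x. qform Q x \<le> a0} \<and>
        is_minimum (qform Q x0) {qform Q x | x. linform p x \<ge> r0}) \<and>
     (x0 \<in> eff_set Q p \<longleftrightarrow>
        is_maximum (linform p x0) {linform p x | x. qform Q x \<le> a0}) \<and>
     (x0 \<in> eff_set Q p \<longleftrightarrow>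
        is_maximum (linform p x0) {linform p x | x. qform Q x = a0}) \<and>
     (x0 \<in> eff_set Q p \<longleftrightarrow>
        is_minimum (qform Q x0) {qform Q x | x. linform p x \<ge> r0}) \<and>
     (x0 \<in> eff_set Q p \<longleftrightarrow>
        is_minimum (qform Q x0) {qform Q x | x. linform p x = r0})"
proof -
  note Qp = assms(1,2)
  \<comment> \<open>Membership yields the bound under the inequality constraint, this restricts to
    the equality constraint, and that returns membership. The same cycle gives \<open>v\<close> and
    \<open>vi\<close>.\<close>
  have iii: "x0 \<in> eff_set Q p \<longleftrightarrow> (\<forall>x. qform Q x \<le> a0 \<longrightarrow> linform p x \<le> r0)"
    and iv: "x0 \<in> eff_set Q p \<longleftrightarrow> (\<forall>x. qform Q x = a0 \<longrightarrow> linform p x \<le> r0)"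
    using eff_set_linform_le[OF Qp, of x0] mem_eff_setI_linform[OF Qp, of x0] assms(3-5)
    by (metis order_refl)+
  have v: "x0 \<in> eff_set Q p \<longleftrightarrow> (\<forall>x. linform p x \<ge> r0 \<longrightarrow> a0 \<le> qform Q x)"
    and vi: "x0 \<in> eff_set Q p \<longleftrightarrow> (\<forall>x. linform p x = r0 \<longrightarrow> a0 \<le> qform Q x)"
    using eff_set_qform_le[OF Qp, of x0] mem_eff_setI_qform[OF Qp, of x0] assms(3-5)
    by (metis order_refl)+
  \<comment> \<open>Attainment is witnessed by \<open>x0\<close> itself, which satisfies each of the
    four constraints.\<close>
  have "is_maximum (linform p x0) {linform p x | x. qform Q x \<le> a0} \<longleftrightarrow> x0 \<in> eff_set Q p"
    unfolding is_maximum_def iii using assms(3,4) by auto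
  moreover have "is_maximum (linform p x0) {linform p x | x. qform Q x = a0} \<longleftrightarrow> x0 \<in> eff_set Q p"
    unfolding is_maximum_def iv using assms(3,4) by auto
  moreover have "is_minimum (qform Q x0) {qform Q x | x. linform p x \<ge> r0} \<longleftrightarrow> x0 \<in> eff_set Q p"
    unfolding is_minimum_def v using assms(3,4) by auto
  moreover have "is_minimum (qform Q x0) {qform Q x | x. linform p x = r0} \<longleftrightarrow> x0 \<in> eff_set Q p"
    unfolding is_minimum_def vi using assms(3,4) by auto
  \<comment> \<open>The joint condition is a conjunction of two conditions each equivalent to
    membership.\<close>
  ultimately show ?thesis by simp
qed

end
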